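(* The tropical chromatic number of $\mathbb{R}^n$ satisfies $$\chi_{\mathrm{tr}}(\mathbb{R}^n)\ \ge\ \Omega\!\left(\frac{2^n}{\sqrt{n}}\right)\qquad (n\to\infty),$$ that is, there exist a constant $c>0$ and an integer $n_0$ such that $\chi_{\mathrm{tr}}(\mathbb{R}^n)\ge c\,2^n/\sqrt{n}$ for all integers $n\ge n_0$.
   Context: The tropical distance between $\mathbf{x}=(x_1,\ldots,x_n)$ and $\mathbf{y}=(y_1,\ldots,y_n)$ in $\mathbb{R}^n$ is $$d_{\mathrm{tr}}(\mathbf{x},\mathbf{y}) = \max\Big\{\max_{1\le i\le n}|x_i-y_i|,\ \max_{1\le i,j\le n}(x_i-y_i-x_j+y_j)\Big\} = \max\Big\{\max_{1\le i\le n}(x_i-y_i),0\Big\}-\min\Big\{\min_{1\le i\le n}(x_i-y_i),0\Big\}.$$ The tropical chromatic number $\chi_{\mathrm{tr}}(\mathbb{R}^n)$ is the minimal number of colors needed to color the points of $\mathbb{R}^n$ in such a way that no two points at tropical distance $1$ from one another have the same color. No measurability or other regularity condition is imposed on the color classes. *)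

theory Defs
  imports Complex_Main "HOL-Library.FuncSet" "HOL-Library.Extended_Nat" "HOL-Library.Extended_Real"
begin

text \<open>
  The dimension has to be an ordinary natural number, so points of $R^n$ are functions on
  the index set \<open>{1..n}\<close>, made unique by being \<open>undefined\<close> outside it.
\<close>

definition Rn :: "nat \<Rightarrow> (nat \<Rightarrow> real) set" where
  "Rn n = {1..n} \<rightarrow>\<^sub>E UNIV"

text \<open>For \<open>n = 0\<close> the maxima range over empty sets and the value is unspecified.\<close>

definition tropical_dist :: "nat \<Rightarrow> (nat \<Rightarrow> real) \<Rightarrow> (nat \<Rightarrow> real) \<Rightarrow> real" where
  "tropical_dist n x y =
     max (MAX i\<in>{1..n}. \<bar>x i - y i\<bar>)
         (MAX (i, j)\<in>{1..n} \<times> {1..n}. x i - y i - x j + y j)"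

lemma tropical_dist_altdef:
  assumes "n \<ge> 1"
  shows "tropical_dist n x y =
           max (MAX i\<in>{1..n}. x i - y i) 0 - min (MIN i\<in>{1..n}. x i - y i) 0"
proof -
  define d where "d i = x i - y i" for i
  define M where "M = Max (d ` {1..n})"
  define m where "m = Min (d ` {1..n})"
  have ne: "{1..n} \<noteq> {}" using assms by auto
  have fin: "finite (d ` {1..n})" by simp
  have "M \<in> d ` {1..n}" "m \<in> d ` {1..n}"
    using ne unfolding M_def m_def by (intro Max_in Min_in; simp)+
  then obtain a b where a: "a \<in> {1..n}" "M = d a" and b: "b \<in> {1..n}" "m = d b" by auto
  have bnd: "d i \<le> M" "m \<le> d i" if "i \<in> {1..n}" for i
    using that unfolding M_def m_def by auto
  have 1: "(MAX (i, j)\<in>{1..n} \<times> {1..n}. x i - y i - x j + y j) = M - m"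
  proof (rule Max_eqI)
    show "M - m \<in> (\<lambda>(i, j). x i - y i - x j + y j) ` ({1..n} \<times> {1..n})"
      by (rule image_eqI[of _ _ "(a, b)"]) (use a(1) b(1) in \<open>simp_all add: a(2) b(2) d_def\<close>)
  next
    fix z assume "z \<in> (\<lambda>(i, j). x i - y i - x j + y j) ` ({1..n} \<times> {1..n})"
    then obtain i j where "i \<in> {1..n}" "j \<in> {1..n}" "z = d i - d j" by (auto simp: d_def)
    then show "z \<le> M - m" using bnd(1)[of i] bnd(2)[of j] by linarith
  qed simp
  have 2: "(MAX i\<in>{1..n}. \<bar>x i - y i\<bar>) = max M (- m)"
  proof (rule Max_eqI)
    have "m \<le> M" using bnd(1)[OF b(1)] b(2) by linarith
    then have "max M (- m) = \<bar>M\<bar> \<or> max M (- m) = \<bar>m\<bar>" by linarith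
    then have "max M (- m) = \<bar>x a - y a\<bar> \<or> max M (- m) = \<bar>x b - y b\<bar>"
      by (simp only: a(2) b(2) d_def)
    then show "max M (- m) \<in> (\<lambda>i. \<bar>x i - y i\<bar>) ` {1..n}"
      using a(1) b(1) by blast
  next
    fix z assume "z \<in> (\<lambda>i. \<bar>x i - y i\<bar>) ` {1..n}"
    then obtain i where "i \<in> {1..n}" "z = \<bar>d i\<bar>" by (auto simp: d_def)
    then show "z \<le> max M (- m)" using bnd(1)[of i] bnd(2)[of i] by linarith
  qed simp
  have "m \<le> M" using bnd(1)[OF b(1)] b(2) by linarith
  then have 3: "max (max M (- m)) (M - m) = max M 0 - min m 0" by linarith
  have 4: "(MAX i\<in>{1..n}. x i - y i) = M" "(MIN i\<in>{1..n}. x i - y i) = m"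
    by (simp_all add: M_def m_def d_def cong: image_cong)
  show ?thesis
    unfolding tropical_dist_def 1 2 4 3 ..
qed

definition tropical_coloring :: "nat \<Rightarrow> nat \<Rightarrow> ((nat \<Rightarrow> real) \<Rightarrow> nat) \<Rightarrow> bool" where
  "tropical_coloring n k f \<longleftrightarrow>
     f \<in> Rn n \<rightarrow> {..<k} \<and>
     (\<forall>x\<in>Rn n. \<forall>y\<in>Rn n. tropical_dist n x y = 1 \<longrightarrow> f x \<noteq> f y)"

text \<open>The infimum is \<open>\<infinity>\<close> if no finite number of colors suffices.\<close>

definition tropical_chromatic_number :: "nat \<Rightarrow> enat" where
  "tropical_chromatic_number n = (INF k\<in>{k. \<exists>f. tropical_coloring n k f}. enat k)"

end

theory Submission
  imports Defs
begin

text \<open>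
  For \<open>n \<ge> 1\<close> every colouring needs at least \<open>2 ^ (n - 1)\<close> colours, which is more than the
  theorem asks for. The bound is already forced by the points of \<open>R\<^sup>n\<close> with
  coordinates in \<open>{0, 1/2, 1, ...}\<close>, and it comes from the density of a single colour class.

  Scale these points by \<open>2\<close>, and let \<open>S\<close> be a colour class, so that no two points of \<open>S\<close> are at
  scaled distance \<open>2\<close>. If all coordinates of \<open>s\<close> and \<open>t\<close> in \<open>S\<close> differ by at most \<open>1\<close>, then
  \<open>s\<close> and \<open>t\<close> are comparable coordinatewise, because differences of both signs would give scaled
  distance exactly \<open>2\<close> (\<open>tropical_dist_half_eq_1\<close>). So the points of \<open>S\<close> in any
  unit cube form a chain, and for each \<open>s\<close> one can choose a coordinate \<open>j\<close> in which \<open>s\<close> strictly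
  exceeds all other points of \<open>S\<close> in the unit cube below it (\<open>exists_strict_coordinate\<close>).

  Attach to \<open>s\<close> the upper half \<open>{y. y - s \<in> {0,1}\<^sup>n, y\<^sub>j = s\<^sub>j + 1}\<close> of the unit cube above
  it. This half-cube has \<open>2 ^ (n - 1)\<close> points, and half-cubes of different points of \<open>S\<close> are
  disjoint: a common point would make the two points close, hence comparable, and it would exceed
  the smaller one by at least \<open>2\<close> in the coordinate chosen for the larger one. Hence a colour class has
  density at most \<open>1 / 2 ^ (n - 1)\<close> (\<open>card_locally_chained_le\<close>). Comparing cardinalities
  in a box of side \<open>N\<close> gives \<open>N ^ n * 2 ^ (n - 1) \<le> k * (N + 1) ^ n\<close> for \<open>k\<close> colours, and
  \<open>N \<rightarrow> \<infinity>\<close> gives \<open>2 ^ (n - 1) \<le> k\<close>.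
\<close>

text \<open>
  Points that are extensional on the index set are compared by the order of functions; it agrees
  with the coordinatewise order on the index set.
\<close>

definition locally_chained :: "'i set \<Rightarrow> ('i \<Rightarrow> nat) set \<Rightarrow> bool" where
  "locally_chained I S \<longleftrightarrow>
     (\<forall>s\<in>S. \<forall>t\<in>S. (\<forall>i\<in>I. s i \<le> t i + 1 \<and> t i \<le> s i + 1) \<longrightarrow> s \<le> t \<or> t \<le> s)"

text \<open>
  The other points of \<open>S\<close> in the unit cube below \<open>s\<close> are pairwise close and so form a finite chain. A
  coordinate that separates \<open>s\<close> from the top of this chain separates it from the whole chain.
\<close>

lemma exists_strict_coordinate:
  assumes S: "finite S" "S \<subseteq> extensional I" "locally_chained I S"
    and I: "I \<noteq> {}" and s: "s \<in> S"
  shows "\<exists>j\<in>I. \<forall>t\<in>S. t \<noteq> s \<and> t \<le> s \<and> (\<forall>i\<in>I. s i \<le> t i + 1) \<longrightarrow> t j < s j"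
proof -
  define D where "D = {t\<in>S. t \<noteq> s \<and> t \<le> s \<and> (\<forall>i\<in>I. s i \<le> t i + 1)}"
  show ?thesis
  proof (cases "D = {}")
    case True
    then have "\<not> (t \<noteq> s \<and> t \<le> s \<and> (\<forall>i\<in>I. s i \<le> t i + 1))" if "t \<in> S" for t
      using that unfolding D_def by blast
    then show ?thesis using I by blast
  next
    case False
    have "finite D" using S(1) by (simp add: D_def)
    then obtain m where m: "m \<in> D" "\<And>b. b \<in> D \<Longrightarrow> m \<le> b \<Longrightarrow> m = b"
      using finite_has_maximal[OF _ False] by blast
    have top: "t \<le> m" if "t \<in> D" for t
    proof -
      have "t i \<le> m i + 1 \<and> m i \<le> t i + 1" if "i \<in> I" for i
      proof -
        have "t i \<le> s i" "m i \<le> s i" "s i \<le> t i + 1" "s i \<le> m i + 1"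
          using \<open>t \<in> D\<close> m(1) that by (auto simp: D_def le_fun_def)
        then show ?thesis by linarith
      qed
      then have "t \<le> m \<or> m \<le> t"
        using S(3) that m(1) unfolding locally_chained_def D_def by blast
      then show ?thesis using m(2)[OF that] by auto
    qed
    have "\<exists>j\<in>I. m j \<noteq> s j"
    proof (rule ccontr)
      assume "\<not> (\<exists>j\<in>I. m j \<noteq> s j)"
      moreover have "m \<in> extensional I" "s \<in> extensional I"
        using m(1) s S(2) by (auto simp: D_def)
      ultimately have "m = s" by (intro extensionalityI) auto
      then show False using m(1) by (simp add: D_def)
    qed
    then obtain j where j: "j \<in> I" "m j \<noteq> s j" by blast
    have "m j < s j" using j(2) m(1) by (simp add: D_def le_fun_def order_less_le)
    then have "t j < s j" if "t \<in> D" for t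
      using top[OF that] by (meson le_funD le_less_trans)
    then show ?thesis using j(1) by (auto simp: D_def)
  qed
qed

text \<open>
  The half-cubes above the points of \<open>S\<close> are disjoint, and they lie in a box that is only one unit
  wider than the box that contains \<open>S\<close>.
\<close>

lemma card_locally_chained_le:
  assumes I: "finite I" "I \<noteq> {}"
    and S: "S \<subseteq> I \<rightarrow>\<^sub>E {..<N}" "locally_chained I S"
  shows "card S * 2 ^ (card I - 1) \<le> (N + 1) ^ card I"
proof -
  have fS: "finite S" using S(1) I(1) by (meson finite_PiE finite_lessThan finite_subset)
  have "S \<subseteq> extensional I" using S(1) by (auto simp: PiE_def)
  then have "\<forall>s\<in>S. \<exists>j\<in>I. \<forall>t\<in>S. t \<noteq> s \<and> t \<le> s \<and> (\<forall>i\<in>I. s i \<le> t i + 1) \<longrightarrow> t j < s j"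
    using exists_strict_coordinate[OF fS _ S(2) I(2)] by blast
  then obtain j where jI: "\<And>s. s \<in> S \<Longrightarrow> j s \<in> I"
    and j: "\<And>s t. s \<in> S \<Longrightarrow> t \<in> S \<Longrightarrow> t \<noteq> s \<Longrightarrow> t \<le> s \<Longrightarrow>
              (\<forall>i\<in>I. s i \<le> t i + 1) \<Longrightarrow> t (j s) < s (j s)"
    by metis
  define T where
    "T s = (\<Pi>\<^sub>E i\<in>I. if i = j s then {s i + 1} else {s i, s i + 1})" for s
  have TD: "y (j s) = s (j s) + 1" "\<forall>i\<in>I. s i \<le> y i \<and> y i \<le> s i + 1"
    if "s \<in> S" "y \<in> T s" for s y
  proof -
    have *: "y i \<in> (if i = j s then {s i + 1} else {s i, s i + 1})" if "i \<in> I" for i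
      using \<open>y \<in> T s\<close> that unfolding T_def by (rule PiE_mem)
    show "y (j s) = s (j s) + 1" using *[OF jI[OF that(1)]] by simp
    show "\<forall>i\<in>I. s i \<le> y i \<and> y i \<le> s i + 1" using * by (force split: if_splits)
  qed
  have no_common: False if "s \<in> S" "t \<in> S" "t \<noteq> s" "t \<le> s" "y \<in> T s" "y \<in> T t" for s t y
  proof -
    have "\<forall>i\<in>I. s i \<le> t i + 1" using TD(2)[of s y] TD(2)[of t y] that by fastforce
    then have "t (j s) < s (j s)" using j that by blast
    moreover have "y (j s) \<le> t (j s) + 1" using TD(2)[of t y] jI that by blast
    ultimately show False using TD(1)[of s y] that by simp
  qed
  have disj: "T s \<inter> T t = {}" if "s \<in> S" "t \<in> S" "s \<noteq> t" for s t
  proof (rule ccontr)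
    assume "T s \<inter> T t \<noteq> {}"
    then obtain y where y: "y \<in> T s" "y \<in> T t" by blast
    have "\<forall>i\<in>I. s i \<le> t i + 1 \<and> t i \<le> s i + 1"
      using TD(2)[of s y] TD(2)[of t y] that y by fastforce
    then have "s \<le> t \<or> t \<le> s" using S(2) that unfolding locally_chained_def by blast
    then show False using no_common that y by metis
  qed
  have cardT: "card (T s) = 2 ^ (card I - 1)" if "s \<in> S" for s
  proof -
    have "card (T s) = (\<Prod>i\<in>I. if i = j s then 1 else 2)"
      unfolding T_def card_PiE[OF I(1)] by (rule prod.cong) auto
    also have "\<dots> = (\<Prod>i\<in>I - {j s}. 2)"
      by (subst prod.remove[OF I(1) jI[OF that]]) (auto intro!: prod.cong)
    also have "\<dots> = 2 ^ (card I - 1)" using I(1) jI[OF that] by simp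
    finally show ?thesis .
  qed
  have finT: "finite (T s)" for s unfolding T_def using I(1) by (intro finite_PiE) auto
  have sub: "(\<Union>s\<in>S. T s) \<subseteq> I \<rightarrow>\<^sub>E {..N}"
  proof
    fix y assume "y \<in> (\<Union>s\<in>S. T s)"
    then obtain s where s: "s \<in> S" "y \<in> T s" by blast
    have "y i \<in> {..N}" if "i \<in> I" for i
    proof -
      have "s i \<in> {..<N}" using S(1) s(1) that by (blast intro: PiE_mem)
      then show ?thesis using TD(2)[OF s] that by fastforce
    qed
    moreover have "y \<in> extensional I" using s(2) by (simp add: T_def PiE_def)
    ultimately show "y \<in> I \<rightarrow>\<^sub>E {..N}" by (simp add: PiE_iff)
  qed
  have "card S * 2 ^ (card I - 1) = (\<Sum>s\<in>S. card (T s))" by (simp add: cardT)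
  also have "\<dots> = card (\<Union>s\<in>S. T s)"
    using fS finT disj by (intro card_UN_disjoint[symmetric]) auto
  also have "\<dots> \<le> card (I \<rightarrow>\<^sub>E {..N})"
    using sub I(1) by (intro card_mono finite_PiE) auto
  also have "\<dots> = (N + 1) ^ card I" using I(1) by (simp add: card_PiE)
  finally show ?thesis .
qed

definition half_point :: "nat \<Rightarrow> (nat \<Rightarrow> nat) \<Rightarrow> nat \<Rightarrow> real" where
  "half_point n u = (\<lambda>i\<in>{1..n}. real (u i) / 2)"

lemma half_point_in_Rn: "half_point n u \<in> Rn n"
  by (simp add: half_point_def Rn_def)

text \<open>
  The largest coordinate difference is \<open>1/2\<close> and the smallest is \<open>-1/2\<close>; the tropical distance
  is the gap between them.
\<close>

lemma tropical_dist_half_eq_1: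
  assumes close: "\<And>i. i \<in> {1..n} \<Longrightarrow> u i \<le> v i + 1 \<and> v i \<le> u i + 1"
    and a: "a \<in> {1..n}" "v a < u a" and b: "b \<in> {1..n}" "u b < v b"
  shows "tropical_dist n (half_point n u) (half_point n v) = 1"
proof -
  define d where "d i = half_point n u i - half_point n v i" for i
  have d: "d i = (real (u i) - real (v i)) / 2" if "i \<in> {1..n}" for i
    using that by (simp add: d_def half_point_def diff_divide_distrib)
  have bnd: "d i \<le> 1/2 \<and> - 1/2 \<le> d i" if "i \<in> {1..n}" for i
    using close[OF that] unfolding d[OF that] by auto
  have da: "d a = 1/2"
    using close[OF a(1)] a(2) unfolding d[OF a(1)] by auto
  have db: "d b = - 1/2"
    using close[OF b(1)] b(2) unfolding d[OF b(1)] by auto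
  have "(MAX i\<in>{1..n}. d i) = 1/2"
    using bnd a(1) da by (intro Max_eqI) (auto intro!: rev_image_eqI[of a])
  moreover have "(MIN i\<in>{1..n}. d i) = - 1/2"
    using bnd b(1) db by (intro Min_eqI) (auto intro!: rev_image_eqI[of b])
  moreover have "n \<ge> 1" using a(1) by simp
  ultimately show ?thesis by (simp add: tropical_dist_altdef d_def)
qed

lemma locally_chained_colour_class:
  assumes f: "tropical_coloring n k f"
  shows "locally_chained {1..n} {u \<in> {1..n} \<rightarrow>\<^sub>E {..<N}. f (half_point n u) = c}"
  unfolding locally_chained_def
proof (intro ballI impI, rule ccontr)
  fix s t
  assume s: "s \<in> {u \<in> {1..n} \<rightarrow>\<^sub>E {..<N}. f (half_point n u) = c}"
    and t: "t \<in> {u \<in> {1..n} \<rightarrow>\<^sub>E {..<N}. f (half_point n u) = c}"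
    and close: "\<forall>i\<in>{1..n}. s i \<le> t i + 1 \<and> t i \<le> s i + 1"
    and inc: "\<not> (s \<le> t \<or> t \<le> s)"
  have outside: "s i = t i" if "i \<notin> {1..n}" for i
    using s t that by (auto simp: PiE_def extensional_def)
  obtain a where a: "t a < s a" using inc by (auto simp: le_fun_def not_le)
  obtain b where b: "s b < t b" using inc by (auto simp: le_fun_def not_le)
  have "a \<in> {1..n}" "b \<in> {1..n}" using outside a b by (metis less_irrefl)+
  then have "tropical_dist n (half_point n s) (half_point n t) = 1"
    using close a b by (intro tropical_dist_half_eq_1) auto
  then have "f (half_point n s) \<noteq> f (half_point n t)"
    using f half_point_in_Rn unfolding tropical_coloring_def by blast
  then show False using s t by simp
qed

lemma tropical_coloring_box_bound:
  assumes n: "n \<ge> 1" and f: "tropical_coloring n k f"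
  shows "N ^ n * 2 ^ (n - 1) \<le> k * (N + 1) ^ n"
proof -
  define B where "B = ({1..n} \<rightarrow>\<^sub>E {..<N})"
  define C where "C c = {u \<in> B. f (half_point n u) = c}" for c
  have "f (half_point n u) < k" for u
    using f half_point_in_Rn[of n u] unfolding tropical_coloring_def by blast
  then have "B = (\<Union>c<k. C c)" by (auto simp: C_def)
  then have "card B \<le> (\<Sum>c<k. card (C c))" by (metis card_UN_le finite_lessThan)
  moreover have "card B = N ^ n" by (simp add: B_def card_PiE)
  ultimately have "N ^ n * 2 ^ (n - 1) \<le> (\<Sum>c<k. card (C c) * 2 ^ (n - 1))"
    by (metis mult_le_mono1 sum_distrib_right)
  also have "\<dots> \<le> (\<Sum>c<k. (N + 1) ^ n)"
  proof (rule sum_mono)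
    fix c
    have "locally_chained {1..n} (C c)"
      unfolding C_def B_def using f by (rule locally_chained_colour_class)
    then show "card (C c) * 2 ^ (n - 1) \<le> (N + 1) ^ n"
      using card_locally_chained_le[of "{1..n}" "C c" N] n by (auto simp: C_def B_def)
  qed
  finally show ?thesis by simp
qed

text \<open>
  The loss at the boundary of the box of side \<open>N\<close> is the factor \<open>((N + 1) / N) ^ n\<close>, which tends
  to \<open>1\<close> for fixed \<open>n\<close>.
\<close>

lemma tropical_coloring_lower_bound:
  assumes n: "n \<ge> 1" and f: "tropical_coloring n k f"
  shows "2 ^ (n - 1) \<le> k"
proof -
  have "(\<lambda>N. real N / real (Suc N)) \<longlonglongrightarrow> 1" by (rule LIMSEQ_n_over_Suc_n)
  then have "(\<lambda>N. (real N / real (Suc N)) ^ n * 2 ^ (n - 1)) \<longlonglongrightarrow> 1 ^ n * 2 ^ (n - 1)"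
    by (intro tendsto_intros)
  moreover have "(real N / real (Suc N)) ^ n * 2 ^ (n - 1) \<le> real k" for N
  proof -
    have "real (N ^ n * 2 ^ (n - 1)) \<le> real (k * (N + 1) ^ n)"
      using tropical_coloring_box_bound[OF n f, of N] by (simp only: of_nat_le_iff)
    then have "real N ^ n * 2 ^ (n - 1) \<le> real k * real (Suc N) ^ n" by (simp add: add.commute)
    then show ?thesis by (simp add: power_divide pos_divide_le_eq del: of_nat_Suc)
  qed
  ultimately have "1 ^ n * 2 ^ (n - 1) \<le> real k"
    by (intro LIMSEQ_le_const2) auto
  then have "real (2 ^ (n - 1)) \<le> real k" by simp
  then show ?thesis by (simp only: of_nat_le_iff)
qed

corollary tropical_chromatic_number_ge:
  assumes "n \<ge> 1"
  shows "enat (2 ^ (n - 1)) \<le> tropical_chromatic_number n"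
  unfolding tropical_chromatic_number_def
  using tropical_coloring_lower_bound[OF assms] by (intro INF_greatest) auto

theorem proposition3p3:
  "\<exists>c::real. c > 0 \<and> (\<exists>n0::nat. \<forall>n\<ge>n0.
     ereal_of_enat (tropical_chromatic_number n) \<ge> ereal (c * 2 ^ n / sqrt (real n)))"
proof (intro exI[of _ "1/2"] conjI exI[of _ 1] allI impI)
  fix n :: nat assume n: "1 \<le> n"
  have "2 ^ n = 2 * (2::real) ^ (n - 1)" using n by (cases n) auto
  then have "1/2 * 2 ^ n / sqrt (real n) = (2::real) ^ (n - 1) / sqrt (real n)" by simp
  also have "\<dots> \<le> 2 ^ (n - 1)"
    using n by (simp add: divide_le_eq mult_le_cancel_left1)
  finally have "ereal (1/2 * 2 ^ n / sqrt (real n)) \<le> ereal_of_enat (enat (2 ^ (n - 1)))" by simp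
  also have "\<dots> \<le> ereal_of_enat (tropical_chromatic_number n)"
    using tropical_chromatic_number_ge[OF n] by (simp only: ereal_of_enat_le_iff)
  finally show "ereal (1/2 * 2 ^ n / sqrt (real n)) \<le> ereal_of_enat (tropical_chromatic_number n)" .
qed simp

end
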